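(* Let the cost distribution function satisfy $F''(c)\le 0$ for any $c\in[0,T)$. Consider the social welfare $W$ as a function of the threshold cost level $c^*\in[0,T]$ ($c^*\in[0,\infty)$ if $T=\infty$). If $HM\ge (H+M)^2T$, then the value of $c^*$ maximizing $W$ is $c^*=T$. If, on the other hand, $HM<(H+M)^2T$, then there is a unique value of $c^*$ that maximizes the social welfare $W$.
   Context: There is a continuum of honest agents of measure $H$ and a continuum of malicious agents of measure $M$, with $H>M>0$. Each honest agent has a cost of running a staking pool, described by a random variable $X$ with atomless density $f$ whose support interval is $[0,T)$, $0<T\le\infty$, and cumulative distribution function $F$ (so $F'=f$). If honest agents with cost below the threshold $c^*$ run pools (malicious agents always do), the measure of honest agents running pools is $P(c^* )=F(c^* )H$. Social welfare is defined as $$W(c^* )=\frac{P(c^* )}{P(c^* )+M}\,H-P(c^* )\,\mathbb{E}[X\mid X<c^*],$$ where $P(c^* )\,\mathbb{E}[X\mid X<c^*]=H\int_0^{c^*}x f(x)\,dx$ (which is $0$ at $c^*=0$). When $T=\infty$, the condition $HM<(H+M)^2T$ is regarded as satisfied. *)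

theory Defs
  imports "HOL-Probability.Probability"
begin

definition pool_measure :: "'a measure \<Rightarrow> ('a \<Rightarrow> real) \<Rightarrow> real \<Rightarrow> real \<Rightarrow> real" where
  "pool_measure \<Omega> X H c = cdf (distr \<Omega> borel X) c * H"

text \<open>
  The conditional expectation of \<open>X\<close> given the event \<open>X < c\<close>.  When that event has
  probability 0 the value is irrelevant, since below it is only used multiplied by
  \<^const>\<open>pool_measure\<close>, which is then 0 as well.
\<close>

definition mean_below :: "'a measure \<Rightarrow> ('a \<Rightarrow> real) \<Rightarrow> real \<Rightarrow> real" where
  "mean_below \<Omega> X c =
     integral\<^sup>L (uniform_measure \<Omega> {\<omega> \<in> space \<Omega>. X \<omega> < c}) X"

definition welfare ::
    "'a measure \<Rightarrow> ('a \<Rightarrow> real) \<Rightarrow> real \<Rightarrow> real \<Rightarrow> real \<Rightarrow> real" where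
  "welfare \<Omega> X H M c =
     pool_measure \<Omega> X H c / (pool_measure \<Omega> X H c + M) * H
     - pool_measure \<Omega> X H c * mean_below \<Omega> X c"

text \<open>
  The upper end \<open>T\<close> of the cost range is an extended real, so that \<open>T = \<infinity>\<close> is allowed.
  Thresholds are real, so for \<open>T = \<infinity>\<close> the second set below is the interval from 0 to
  \<open>\<infinity>\<close>, right-open, just like the first.
\<close>

definition cost_range :: "ereal \<Rightarrow> real set" where
  "cost_range T = {c. 0 \<le> c \<and> ereal c < T}"

definition threshold_range :: "ereal \<Rightarrow> real set" where
  "threshold_range T = {c. 0 \<le> c \<and> ereal c \<le> T}"

end

theory Submission
  imports Defs
begin

text \<open>
  Put \<open>P = F H\<close> and \<open>g(c) = H M / (P(c) + M)\<^sup>2 - c\<close>, so that formally \<open>W' = f H g\<close>.  For \<open>a < b\<close>,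
  bounding \<open>X\<close> by \<open>a\<close> and \<open>b\<close> on the event \<open>a \<le> X < b\<close> gives
  \<open>(P(b) - P(a)) g(b) \<le> W(b) - W(a) \<le> (P(b) - P(a)) g(a)\<close>, strictly when \<open>P(a) < P(b)\<close>.  So \<open>c\<close> is
  the unique maximizer as soon as \<open>g(c) = 0\<close>, or \<open>c\<close> is the right end of the range and
  \<open>g(c) \<ge> 0\<close>.  Otherwise \<open>g\<close> changes sign on the range, hence has a zero there.
\<close>

text \<open>\<open>pool_measure\<close> counts the event X \<le> c, whereas
  \<open>mean_below\<close> conditions on X < c. Without an atom at c the two events have equal
  probability, so the product in \<open>welfare\<close> can be simplified.\<close>

lemma (in prob_space) cdf_distr_eq_prob_less:
  assumes [measurable]: "random_variable borel X"
    and "prob {\<omega> \<in> space M. X \<omega> = c} = 0"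
  shows "cdf (distr M borel X) c = prob {\<omega> \<in> space M. X \<omega> < c}"
proof -
  have "cdf (distr M borel X) c = prob {\<omega> \<in> space M. X \<omega> \<le> c}"
    by (auto simp: cdf_def measure_distr intro!: arg_cong[where f = prob])
  also have "{\<omega> \<in> space M. X \<omega> \<le> c} = {\<omega> \<in> space M. X \<omega> < c} \<union> {\<omega> \<in> space M. X \<omega> = c}"
    by auto
  also have "prob \<dots> = prob {\<omega> \<in> space M. X \<omega> < c}"
    using assms by (subst finite_measure_Union) auto
  finally show ?thesis .
qed

text \<open>Trades the conditional mean for an unconditional expectation, so that costs at two
  thresholds can be subtracted. If the event is null, both sides vanish; otherwise the conditional
  measure has density indicator over probability.\<close>

lemma (in prob_space) prob_times_mean_below:
  assumes [measurable]: "random_variable borel X"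
  shows "prob {\<omega> \<in> space M. X \<omega> < c} * mean_below M X c
    = expectation (\<lambda>\<omega>. indicator {\<omega> \<in> space M. X \<omega> < c} \<omega> * X \<omega>)"
    (is "prob ?A * _ = expectation (\<lambda>\<omega>. indicator _ \<omega> * _ \<omega>)")
proof (cases "prob ?A = 0")
  case True
  then have "AE \<omega> in M. \<omega> \<notin> ?A"
    by (subst prob_eq_0[symmetric]) auto
  then have "expectation (\<lambda>\<omega>. indicator ?A \<omega> * X \<omega>) = expectation (\<lambda>\<omega>. 0)"
    by (intro integral_cong_AE) (auto simp: indicator_def)
  then show ?thesis using True by simp
next
  case False
  have "indicator ?A \<omega> / emeasure M ?A = ennreal (indicator ?A \<omega> / prob ?A)" for \<omega>
    using False
    by (simp add: emeasure_eq_measure divide_ennreal zero_less_measure_iff flip: ennreal_indicator)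
  then have "mean_below M X c = integral\<^sup>L (density M (\<lambda>\<omega>. ennreal (indicator ?A \<omega> / prob ?A))) X"
    by (simp add: mean_below_def uniform_measure_def)
  also have "\<dots> = expectation (\<lambda>\<omega>. (indicator ?A \<omega> * X \<omega>) / prob ?A)"
    by (subst integral_density) auto
  finally show ?thesis using False by simp
qed

lemma (in prob_space) expectation_indicator_less_diff_bounds:
  assumes [measurable]: "random_variable borel X"
    and nonneg: "AE \<omega> in M. 0 \<le> X \<omega>" and "a \<le> b"
  defines "A \<equiv> \<lambda>c. {\<omega> \<in> space M. X \<omega> < c}"
  defines "J \<equiv> \<lambda>c. expectation (\<lambda>\<omega>. indicator (A c) \<omega> * X \<omega>)"
  shows "a * (prob (A b) - prob (A a)) \<le> J b - J a"
    and "J b - J a \<le> b * (prob (A b) - prob (A a))"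
proof -
  have A [measurable]: "A c \<in> events" for c unfolding A_def by measurable
  \<comment> \<open>X itself may have infinite mean. Truncation helps: almost surely the product
    lies between 0 and c if c > 0 and is 0 if c \<le> 0.\<close>
  have int: "integrable M (\<lambda>\<omega>. indicator (A c) \<omega> * X \<omega>)" for c
  proof (rule integrable_const_bound[where B = "\<bar>c\<bar>"])
    show "AE \<omega> in M. norm (indicator (A c) \<omega> * X \<omega>) \<le> \<bar>c\<bar>"
      using nonneg by eventually_elim (auto simp: A_def indicator_def)
  qed measurable
  have intA: "integrable M (indicator (A c) :: _ \<Rightarrow> real)" for c
    by (rule integrable_const_bound[where B = 1]) auto
  have J: "J b - J a = expectation (\<lambda>\<omega>. indicator (A b) \<omega> * X \<omega> - indicator (A a) \<omega> * X \<omega>)"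
    by (simp add: J_def int)
  have P: "k * (prob (A b) - prob (A a)) = expectation (\<lambda>\<omega>. k * (indicator (A b) \<omega> - indicator (A a) \<omega>))" for k
    by (simp add: intA)
  note ints = Bochner_Integration.integrable_diff[OF int int]
    integrable_mult_right[OF Bochner_Integration.integrable_diff[OF intA intA]]
  show "a * (prob (A b) - prob (A a)) \<le> J b - J a" "J b - J a \<le> b * (prob (A b) - prob (A a))"
    unfolding J P using \<open>a \<le> b\<close>
    by (intro integral_mono ints; auto simp: A_def indicator_def)+
qed

text \<open>The payoff x / (x + M) * H has slope H M / (x + M)^2. Its difference quotient between p
  and q is H M / ((p + M) (q + M)), strictly between the slopes at q and at p. Here d stands for the
  increase in total cost.\<close>

lemma payoff_diff_bounds:
  fixes p q H M a b d :: real
  assumes "0 < M" "0 < H" "0 \<le> p" "p < q"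
  shows "H * M / (q + M)\<^sup>2 \<ge> b \<Longrightarrow> d \<le> b * (q - p) \<Longrightarrow> p / (p + M) * H < q / (q + M) * H - d"
    and "H * M / (p + M)\<^sup>2 \<le> a \<Longrightarrow> a * (q - p) \<le> d \<Longrightarrow> q / (q + M) * H - d < p / (p + M) * H"
proof -
  have pos: "0 < p + M" "0 < q + M" using assms by auto
  have diff: "q / (q + M) * H - p / (p + M) * H = H * M / ((p + M) * (q + M)) * (q - p)"
    using pos by (simp add: field_simps)
  have "H * M / (q + M)\<^sup>2 < H * M / ((p + M) * (q + M))"
    using assms pos by (intro divide_strict_left_mono) (auto simp: power2_eq_square)
  then have lower: "H * M / (q + M)\<^sup>2 * (q - p) < H * M / ((p + M) * (q + M)) * (q - p)"
    using assms by (intro mult_strict_right_mono) auto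
  have "H * M / ((p + M) * (q + M)) < H * M / (p + M)\<^sup>2"
    using assms pos by (intro divide_strict_left_mono) (auto simp: power2_eq_square)
  then have upper: "H * M / ((p + M) * (q + M)) * (q - p) < H * M / (p + M)\<^sup>2 * (q - p)"
    using assms by (intro mult_strict_right_mono) auto
  show "p / (p + M) * H < q / (q + M) * H - d"
    if "H * M / (q + M)\<^sup>2 \<ge> b" "d \<le> b * (q - p)"
  proof -
    have "b * (q - p) \<le> H * M / (q + M)\<^sup>2 * (q - p)"
      using that assms by (intro mult_right_mono) auto
    with that lower diff show ?thesis by linarith
  qed
  show "q / (q + M) * H - d < p / (p + M) * H"
    if "H * M / (p + M)\<^sup>2 \<le> a" "a * (q - p) \<le> d"
  proof -
    have "H * M / (p + M)\<^sup>2 * (q - p) \<le> a * (q - p)"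
      using that assms by (intro mult_right_mono) auto
    with that upper diff show ?thesis by linarith
  qed
qed

lemma is_arg_max_iff_eq_if_strict:
  fixes f :: "'a \<Rightarrow> 'b::linorder"
  assumes "P c" "\<And>x. P x \<Longrightarrow> x \<noteq> c \<Longrightarrow> f x < f c"
  shows "is_arg_max f P x \<longleftrightarrow> x = c"
  unfolding is_arg_max_linorder by (metis assms leD order_less_imp_le order_refl)

theorem theorem2:
  fixes \<Omega> :: "'a measure" and X :: "'a \<Rightarrow> real"
    and f F F'' :: "real \<Rightarrow> real" and H M :: real and T :: ereal
  assumes "0 < M" and "M < H" and "0 < T"
    and "prob_space \<Omega>"
    and "distributed \<Omega> lborel X (\<lambda>x. ennreal (f x))"
    and "\<And>x. 0 \<le> f x"
    and "support_on UNIV f = cost_range T"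
    and "F = cdf (distr \<Omega> borel X)"
    and "\<And>c. c \<in> cost_range T \<Longrightarrow> (F has_real_derivative f c) (at c within cost_range T)"
    and "\<And>c. c \<in> cost_range T \<Longrightarrow> (f has_real_derivative F'' c) (at c within cost_range T)"
    and "\<And>c. c \<in> cost_range T \<Longrightarrow> F'' c \<le> 0"
  shows "(ereal (H * M) \<ge> ereal ((H + M)\<^sup>2) * T \<longrightarrow>
            (\<forall>c. is_arg_max (welfare \<Omega> X H M) (\<lambda>c. c \<in> threshold_range T) c
                   \<longleftrightarrow> ereal c = T)) \<and>
         (ereal (H * M) < ereal ((H + M)\<^sup>2) * T \<longrightarrow>
            (\<exists>!c. is_arg_max (welfare \<Omega> X H M) (\<lambda>c. c \<in> threshold_range T) c))"
proof -
  interpret prob_space \<Omega> by fact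
  have H: "0 < H" using assms by simp
  have X [measurable]: "random_variable borel X"
    using distributed_measurable[OF assms(5)] by simp
  have [measurable]: "f \<in> borel_measurable borel"
    using distributed_real_measurable[OF _ assms(5)] assms(6) by simp
  \<comment> \<open>\<open>support_on\<close> is the set where \<open>f\<close> is nonzero, without
    closure, so \<open>f\<close> is positive on the entire cost range, 0 included.\<close>
  have f_pos: "f x > 0 \<longleftrightarrow> x \<in> cost_range T" for x
    using assms(6)[of x] assms(7) by (auto simp: support_on_def less_le)

  have distr: "distr \<Omega> borel X = density lborel (\<lambda>x. ennreal (f x))"
    using distributed_distr_eq_density[OF assms(5)] by (simp cong: distr_cong)
  have "AE x in distr \<Omega> borel X. x \<in> cost_range T"
    unfolding distr by (subst AE_density) (auto simp: f_pos[symmetric])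
  then have range: "AE \<omega> in \<Omega>. X \<omega> \<in> cost_range T"
    by (subst (asm) AE_distr_iff) (auto simp: f_pos[symmetric])
  then have nonneg: "AE \<omega> in \<Omega>. 0 \<le> X \<omega>"
    by eventually_elim (auto simp: cost_range_def)
  have atomless: "measure (distr \<Omega> borel X) {c} = 0" for c
    unfolding distr
    by (simp add: measure_def emeasure_density nn_integral_indicator_singleton)
  have "prob {\<omega> \<in> space \<Omega>. X \<omega> = c} = 0" for c
    using atomless[of c]
    by (simp add: measure_distr) (auto simp: vimage_def Int_def conj_commute)
  note F_prob = cdf_distr_eq_prob_less[OF X this]

  interpret D: real_distribution "distr \<Omega> borel X"
    by (rule real_distribution_distr) (rule X)
  have F_bounds: "0 \<le> F c" "F c \<le> 1" for c
    using D.cdf_nonneg D.cdf_bounded_prob by (auto simp: assms(8))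
  have F_cont: "continuous_on S F" for S
    unfolding assms(8)
    by (intro continuous_at_imp_continuous_on) (auto simp: D.isCont_cdf atomless)

  define P where "P = (\<lambda>c. F c * H)"
  have P_bounds: "0 \<le> P c" "P c \<le> H" for c
    using F_bounds[of c] H by (auto simp: P_def mult_le_cancel_right1)
  have P_strict: "P a < P b" if "a \<in> threshold_range T" "b \<in> threshold_range T" "a < b" for a b
  proof -
    have "F a < F b"
    \<comment> \<open>The derivative is one-sided at 0 and not given at T, so it is used only
      strictly between a and b; continuity of F covers the endpoints.\<close>
    proof (rule DERIV_pos_imp_increasing_open[OF \<open>a < b\<close>])
      fix x assume x: "a < x" "x < b"
      have "{a<..<b} \<subseteq> cost_range T"
        using that by (auto simp: cost_range_def threshold_range_def)
          (meson ereal_less_eq(3) less_ereal.simps(1) order_less_le_trans)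
      then have "x \<in> cost_range T" "x \<in> interior (cost_range T)"
        using x interior_maximal[of "{a<..<b}" "cost_range T"] by auto
      then show "\<exists>y. (F has_real_derivative y) (at x) \<and> 0 < y"
        using assms(9)[of x] f_pos[of x] at_within_interior[of x "cost_range T"] by metis
    qed (rule F_cont)
    then show ?thesis using H by (simp add: P_def)
  qed

  define J where "J = (\<lambda>c. H * expectation (\<lambda>\<omega>. indicator {\<omega> \<in> space \<Omega>. X \<omega> < c} \<omega> * X \<omega>))"
  have J_bounds: "a * (P b - P a) \<le> J b - J a" "J b - J a \<le> b * (P b - P a)" if "a < b" for a b
    using expectation_indicator_less_diff_bounds[OF X nonneg, of a b] that H
    by (simp_all add: P_def J_def assms(8) F_prob mult.commute[of _ H] mult.left_commute[of _ H]
        flip: right_diff_distrib)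
  have W: "welfare \<Omega> X H M c = P c / (P c + M) * H - J c" for c
    using prob_times_mean_below[OF X, of c]
    by (simp add: welfare_def pool_measure_def P_def J_def assms(8) F_prob mult.commute mult.left_commute)

  define g where "g = (\<lambda>c. H * M / (P c + M)\<^sup>2 - c)"
  \<comment> \<open>The sign of \<open>g\<close> is tested at the end least favourable to the claim:
    on [a, b] the payoff slope is smallest and the cost largest at b. For \<open>W_decr\<close> that
    end is a.\<close>
  have W_incr: "welfare \<Omega> X H M a < welfare \<Omega> X H M b"
    if "a \<in> threshold_range T" "b \<in> threshold_range T" "a < b" "0 \<le> g b" for a b
    using payoff_diff_bounds(1)[OF assms(1) H P_bounds(1) P_strict[OF that(1-3)], of b "J b - J a"]
      J_bounds(2)[OF that(3)] that(4) by (simp add: W g_def)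
  have W_decr: "welfare \<Omega> X H M b < welfare \<Omega> X H M a"
    if "a \<in> threshold_range T" "b \<in> threshold_range T" "a < b" "g a \<le> 0" for a b
    using payoff_diff_bounds(2)[OF assms(1) H P_bounds(1) P_strict[OF that(1-3)], of a "J b - J a"]
      J_bounds(1)[OF that(3)] that(4) by (simp add: W g_def)

  show ?thesis
  proof (intro conjI impI allI)
    fix c
    assume le: "ereal ((H + M)\<^sup>2) * T \<le> ereal (H * M)"
    have sq: "0 < (H + M)\<^sup>2" using assms(1) H by simp
    \<comment> \<open>For infinite T the left side of \<open>le\<close> would be infinite, as its
      factor is positive.\<close>
    then obtain t where T: "T = ereal t" "0 < t"
      using le assms(3) by (cases T) auto
    have "H * M / (H + M)\<^sup>2 \<le> H * M / (P t + M)\<^sup>2"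
      using P_bounds[of t] assms(1) H by (intro divide_left_mono power_mono mult_pos_pos) auto
    moreover have "t \<le> H * M / (H + M)\<^sup>2"
      using le sq by (simp add: T pos_le_divide_eq mult.commute)
    ultimately have "0 \<le> g t" by (simp add: g_def)
    then have "is_arg_max (welfare \<Omega> X H M) (\<lambda>c. c \<in> threshold_range T) c \<longleftrightarrow> c = t"
      using T by (intro is_arg_max_iff_eq_if_strict W_incr) (auto simp: threshold_range_def)
    then show "is_arg_max (welfare \<Omega> X H M) (\<lambda>c. c \<in> threshold_range T) c \<longleftrightarrow> ereal c = T"
      by (simp add: T)
  next
    assume less: "ereal (H * M) < ereal ((H + M)\<^sup>2) * T"
    obtain b where b: "b \<in> threshold_range T" "g b \<le> 0"
    proof (cases T)
      case (real t)
      \<comment> \<open>The cost range is right-open, so at threshold T every honest agent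
        participates, up to a null set.\<close>
      have "prob {\<omega> \<in> space \<Omega>. X \<omega> < t} = 1"
        using range by (subst prob_Collect_eq_1) (auto simp: cost_range_def real)
      then have "P t = H" by (simp add: P_def assms(8) F_prob)
      moreover have "H * M / (H + M)\<^sup>2 \<le> t"
        using less assms(1) H by (simp add: real pos_divide_le_eq mult.commute)
      ultimately show ?thesis
        using that[of t] assms(3) by (simp add: g_def threshold_range_def real)
    next
      case PInf
      \<comment> \<open>The witness H / M is the payoff slope at zero participation, which bounds
        the slope at every threshold.\<close>
      have "H * M / (P (H / M) + M)\<^sup>2 \<le> H * M / M\<^sup>2"
        using P_bounds(1)[of "H / M"] assms(1) H
        by (intro divide_left_mono power_mono mult_pos_pos) auto
      then show ?thesis
        using that[of "H / M"] assms(1) H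
        by (simp add: g_def threshold_range_def PInf power2_eq_square)
    qed (use assms(3) in auto)
    have "0 \<le> g 0" using P_bounds(1)[of 0] assms(1) H by (simp add: g_def)
    moreover have "continuous_on {0..b} g"
      unfolding g_def P_def
    proof (intro continuous_intros F_cont ballI)
      fix x
      show "(F x * H + M)\<^sup>2 \<noteq> 0"
        using P_bounds(1)[of x] assms(1) by (simp add: P_def)
    qed
    ultimately obtain c where c: "0 \<le> c" "c \<le> b" "g c = 0"
      using IVT2'[of g b 0 0] b by (auto simp: threshold_range_def)
    have "c \<in> threshold_range T"
      using b c by (auto simp: threshold_range_def) (meson ereal_less_eq(3) order_trans)
    \<comment> \<open>With g c = 0 both sign conditions hold at c: \<open>W_incr\<close> handles the
      thresholds below c, \<open>W_decr\<close> those above.\<close>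
    then have "is_arg_max (welfare \<Omega> X H M) (\<lambda>c. c \<in> threshold_range T) x \<longleftrightarrow> x = c" for x
      using c W_incr[of _ c] W_decr[of c]
      by (intro is_arg_max_iff_eq_if_strict) (auto simp: neq_iff)
    then show "\<exists>!c. is_arg_max (welfare \<Omega> X H M) (\<lambda>c. c \<in> threshold_range T) c"
      by simp
  qed
qed

end
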